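(* The calculus $\mathbf{ACT}^+_\omega$ is strongly complete w.r.t. PSCL-models with non-standard $\bot$: for any (possibly infinite) set of sequents $\mathcal{H}$ and any sequent $\Pi \to C$, if every PSCL-model with non-standard $\bot$ in which all sequents of $\mathcal{H}$ are true also makes $\Pi \to C$ true, then $\Pi \to C$ is derivable in $\mathbf{ACT}^+_\omega$ from $\mathcal{H}$.
   Context: Formulae are built from countably many variables and constants $\top,\bot$ using $\backslash$, $/$, $\cdot$, $\wedge$, $\vee$ and unary positive iteration ${}^+$. Sequents have the form $A_1,\dots,A_n \to B$ with $n\ge 1$ (Lambek's non-emptiness restriction; hypotheses also have non-empty antecedents). $\mathbf{MALC}^+$ is the multiplicative-additive Lambek calculus with axioms $A\to A$, $\Gamma,\bot,\Delta\to C$, $\Pi\to\top$, the usual left/right rules for $\cdot,\backslash,/,\wedge,\vee$ (with $\backslash$R, $/$R requiring non-empty $\Pi$), and Cut. $\mathbf{ACT}^+_\omega$ adds the $\omega$-rule: from $\Gamma,A^n,\Delta\to C$ for all $n\ge1$ infer $\Gamma,A^+,\Delta\to C$, and for $n\ge1$: from $\Pi_i\to A$ ($i=1..n$) infer $\Pi_1,\dots,\Pi_n\to A^+$. Derivability from hypotheses $\mathcal{H}$ treats them as extra axioms. PSCL-models: fix an alphabet $\Sigma$ and a language $L\subseteq\Sigma^+$. For $M\subseteq\Sigma^+$ let $M^{\rhd}=\{(x,y)\in\Sigma^*\times\Sigma^*\mid \forall w\in M\; xwy\in L\}$, and for a set of contexts $C$ let $C^{\lhd}=\{v\in\Sigma^+\mid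 \forall (x,y)\in C\; xvy\in L\}$. The set of closed languages $\{M\subseteq\Sigma^+\mid M=M^{\rhd\lhd}\}$ is ordered by $\subseteq$, with meet $\cap$, join $(M_1\cup M_2)^{\rhd\lhd}$, product $(M_1\cdot M_2)^{\rhd\lhd}$, divisions $M_1\backslash M_2=\{u\in\Sigma^+\mid\forall v\in M_1\; vu\in M_2\}$ and symmetric $/$, positive iteration $(M^+)^{\rhd\lhd}$, $\top=\Sigma^+$; this forms a $*$-continuous positive action lattice. A closed language $Z$ is a local zero if for every closed $M\supseteq Z$ we have $(M\cdot Z)^{\rhd\lhd}=(Z\cdot M)^{\rhd\lhd}=Z$; then the upper cone $\{M \text{ closed}\mid Z\subseteq M\}$ is closed under all operations, and taking $Z$ as the new $\bot$ gives a structure. A PSCL-model with non-standard $\bot$ is an interpretation of formulae in such an upper cone commuting with the operations and mapping $\top,\bot$ to $\Sigma^+, Z$; a sequent $A_1,\dots,A_n\to B$ is true if the (closed) product of the interpretations of the $A_i$ is contained in the interpretation of $B$. *)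

theory Defs
  imports Main
begin

datatype fm =
    Var nat
  | Top
  | Bot
  | Under fm fm  (infixr "\<rightharpoondown>" 65)  \<comment> \<open>\<open>A \<rightharpoondown> B\<close> is left division: \<open>A\<close> under \<open>B\<close>\<close>
  | Over fm fm   (infixl "\<leftharpoondown>" 65)  \<comment> \<open>\<open>B \<leftharpoondown> A\<close> is right division: \<open>B\<close> over \<open>A\<close>\<close>
  | Prod fm fm   (infixl "\<odot>" 70)
  | And fm fm    (infixl "\<sqinter>\<^sub>f" 60)
  | Or fm fm     (infixl "\<squnion>\<^sub>f" 60)
  | Iter fm      ("_\<^sup>\<oplus>" [1000] 1000)

type_synonym sequent = "fm list \<times> fm"

text \<open>Lambek's non-emptiness restriction.\<close>

definition wf_sequent :: "sequent \<Rightarrow> bool" where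
  "wf_sequent S \<longleftrightarrow> fst S \<noteq> []"

text \<open>
  Derivability from a set \<open>H\<close> of hypotheses. If all hypotheses are well-formed, then every
  derivable sequent has a non-empty antecedent, so the restriction has to be imposed explicitly
  only in the axiom for \<^const>\<open>Top\<close> and in the right rules for the divisions.
\<close>

inductive ACT :: "sequent set \<Rightarrow> fm list \<Rightarrow> fm \<Rightarrow> bool" for H :: "sequent set" where
  hyp: "(\<Gamma>, C) \<in> H \<Longrightarrow> ACT H \<Gamma> C"
| ax: "ACT H [A] A"
| bot: "ACT H (\<Gamma> @ [Bot] @ \<Delta>) C"
| top: "\<Pi> \<noteq> [] \<Longrightarrow> ACT H \<Pi> Top"
| prodL: "ACT H (\<Gamma> @ [A, B] @ \<Delta>) C \<Longrightarrow> ACT H (\<Gamma> @ [A \<odot> B] @ \<Delta>) C"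
| prodR: "ACT H \<Gamma> A \<Longrightarrow> ACT H \<Delta> B \<Longrightarrow> ACT H (\<Gamma> @ \<Delta>) (A \<odot> B)"
| underL: "ACT H \<Pi> A \<Longrightarrow> ACT H (\<Gamma> @ [B] @ \<Delta>) C \<Longrightarrow> ACT H (\<Gamma> @ \<Pi> @ [A \<rightharpoondown> B] @ \<Delta>) C"
| underR: "\<Pi> \<noteq> [] \<Longrightarrow> ACT H ([A] @ \<Pi>) B \<Longrightarrow> ACT H \<Pi> (A \<rightharpoondown> B)"
| overL: "ACT H \<Pi> A \<Longrightarrow> ACT H (\<Gamma> @ [B] @ \<Delta>) C \<Longrightarrow> ACT H (\<Gamma> @ [B \<leftharpoondown> A] @ \<Pi> @ \<Delta>) C"
| overR: "\<Pi> \<noteq> [] \<Longrightarrow> ACT H (\<Pi> @ [A]) B \<Longrightarrow> ACT H \<Pi> (B \<leftharpoondown> A)"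
| andL1: "ACT H (\<Gamma> @ [A] @ \<Delta>) C \<Longrightarrow> ACT H (\<Gamma> @ [A \<sqinter>\<^sub>f B] @ \<Delta>) C"
| andL2: "ACT H (\<Gamma> @ [B] @ \<Delta>) C \<Longrightarrow> ACT H (\<Gamma> @ [A \<sqinter>\<^sub>f B] @ \<Delta>) C"
| andR: "ACT H \<Pi> A \<Longrightarrow> ACT H \<Pi> B \<Longrightarrow> ACT H \<Pi> (A \<sqinter>\<^sub>f B)"
| orL: "ACT H (\<Gamma> @ [A] @ \<Delta>) C \<Longrightarrow> ACT H (\<Gamma> @ [B] @ \<Delta>) C \<Longrightarrow> ACT H (\<Gamma> @ [A \<squnion>\<^sub>f B] @ \<Delta>) C"
| orR1: "ACT H \<Pi> A \<Longrightarrow> ACT H \<Pi> (A \<squnion>\<^sub>f B)"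
| orR2: "ACT H \<Pi> B \<Longrightarrow> ACT H \<Pi> (A \<squnion>\<^sub>f B)"
| iterL: "(\<And>n. n \<ge> 1 \<Longrightarrow> ACT H (\<Gamma> @ replicate n A @ \<Delta>) C) \<Longrightarrow> ACT H (\<Gamma> @ [A\<^sup>\<oplus>] @ \<Delta>) C"
| iterR: "\<Pi>s \<noteq> [] \<Longrightarrow> (\<And>\<Pi>. \<Pi> \<in> set \<Pi>s \<Longrightarrow> ACT H \<Pi> A) \<Longrightarrow> ACT H (concat \<Pi>s) (A\<^sup>\<oplus>)"
| cut: "ACT H \<Pi> A \<Longrightarrow> ACT H (\<Gamma> @ [A] @ \<Delta>) C \<Longrightarrow> ACT H (\<Gamma> @ \<Pi> @ \<Delta>) C"

type_synonym 'a lang = "'a list set"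

definition words_plus :: "'a set \<Rightarrow> 'a lang" where
  "words_plus \<Sigma> = lists \<Sigma> - {[]}"

definition conc :: "'a lang \<Rightarrow> 'a lang \<Rightarrow> 'a lang" where
  "conc M N = {u @ v | u v. u \<in> M \<and> v \<in> N}"

definition lang_plus :: "'a lang \<Rightarrow> 'a lang" where
  "lang_plus M = {concat ws | ws. ws \<noteq> [] \<and> set ws \<subseteq> M}"

definition contexts :: "'a set \<Rightarrow> 'a lang \<Rightarrow> 'a lang \<Rightarrow> ('a list \<times> 'a list) set" where
  "contexts \<Sigma> L M = {(x, y). x \<in> lists \<Sigma> \<and> y \<in> lists \<Sigma> \<and> (\<forall>w\<in>M. x @ w @ y \<in> L)}"

definition fillers :: "'a set \<Rightarrow> 'a lang \<Rightarrow> ('a list \<times> 'a list) set \<Rightarrow> 'a lang" where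
  "fillers \<Sigma> L K = {v \<in> words_plus \<Sigma>. \<forall>(x, y)\<in>K. x @ v @ y \<in> L}"

definition cl :: "'a set \<Rightarrow> 'a lang \<Rightarrow> 'a lang \<Rightarrow> 'a lang" where
  "cl \<Sigma> L M = fillers \<Sigma> L (contexts \<Sigma> L M)"

definition closed_lang :: "'a set \<Rightarrow> 'a lang \<Rightarrow> 'a lang \<Rightarrow> bool" where
  "closed_lang \<Sigma> L M \<longleftrightarrow> M \<subseteq> words_plus \<Sigma> \<and> M = cl \<Sigma> L M"

definition under_lang :: "'a set \<Rightarrow> 'a lang \<Rightarrow> 'a lang \<Rightarrow> 'a lang" where
  "under_lang \<Sigma> M N = {u \<in> words_plus \<Sigma>. \<forall>v\<in>M. v @ u \<in> N}"

definition over_lang :: "'a set \<Rightarrow> 'a lang \<Rightarrow> 'a lang \<Rightarrow> 'a lang" where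
  "over_lang \<Sigma> N M = {u \<in> words_plus \<Sigma>. \<forall>v\<in>M. u @ v \<in> N}"

definition local_zero :: "'a set \<Rightarrow> 'a lang \<Rightarrow> 'a lang \<Rightarrow> bool" where
  "local_zero \<Sigma> L Z \<longleftrightarrow> closed_lang \<Sigma> L Z \<and>
    (\<forall>M. closed_lang \<Sigma> L M \<and> Z \<subseteq> M \<longrightarrow>
       cl \<Sigma> L (conc M Z) = Z \<and> cl \<Sigma> L (conc Z M) = Z)"

text \<open>
  A model with non-standard bottom: \<open>I\<close> interprets formulae in the upper cone of the local zero
  \<open>Z\<close>. The alphabet \<open>\<Sigma>\<close> is an arbitrary set of letters, finite or infinite.
\<close>

definition pscl_model :: "'a set \<Rightarrow> 'a lang \<Rightarrow> 'a lang \<Rightarrow> (fm \<Rightarrow> 'a lang) \<Rightarrow> bool" where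
  "pscl_model \<Sigma> L Z I \<longleftrightarrow>
    L \<subseteq> words_plus \<Sigma> \<and>
    local_zero \<Sigma> L Z \<and>
    (\<forall>A. closed_lang \<Sigma> L (I A) \<and> Z \<subseteq> I A) \<and>
    I Top = words_plus \<Sigma> \<and>
    I Bot = Z \<and>
    (\<forall>A B. I (A \<odot> B) = cl \<Sigma> L (conc (I A) (I B))) \<and>
    (\<forall>A B. I (A \<rightharpoondown> B) = under_lang \<Sigma> (I A) (I B)) \<and>
    (\<forall>A B. I (B \<leftharpoondown> A) = over_lang \<Sigma> (I B) (I A)) \<and>
    (\<forall>A B. I (A \<sqinter>\<^sub>f B) = I A \<inter> I B) \<and>
    (\<forall>A B. I (A \<squnion>\<^sub>f B) = cl \<Sigma> L (I A \<union> I B)) \<and>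
    (\<forall>A. I (A\<^sup>\<oplus>) = cl \<Sigma> L (lang_plus (I A)))"

text \<open>
  The antecedent is interpreted by the iterated closed product, associated to the left. Only
  sequents with non-empty antecedent are meant here.
\<close>

definition true_in :: "'a set \<Rightarrow> 'a lang \<Rightarrow> (fm \<Rightarrow> 'a lang) \<Rightarrow> sequent \<Rightarrow> bool" where
  "true_in \<Sigma> L I S \<longleftrightarrow>
    foldl (\<lambda>M A. cl \<Sigma> L (conc M (I A))) (I (hd (fst S))) (tl (fst S)) \<subseteq> I (snd S)"

text \<open>
  Truth of a sequent in all models of the hypotheses. Since quantification over types is not
  possible, letters are natural numbers, i.e. up to renaming all finite and countably infinite
  alphabets are considered. Completeness with respect to these models implies completeness with
  respect to models over alphabets of arbitrary cardinality.
\<close>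

definition pscl_consequence :: "sequent set \<Rightarrow> sequent \<Rightarrow> bool" where
  "pscl_consequence H S \<longleftrightarrow>
    (\<forall>(\<Sigma> :: nat set) L Z I.
       pscl_model \<Sigma> L Z I \<and> (\<forall>T\<in>H. true_in \<Sigma> L I T) \<longrightarrow> true_in \<Sigma> L I S)"

end

(*
  The model is canonical. Words over plain and barred letters are read as sequences of formulae in
  which every barred letter stands for Top, and a word belongs to the language iff it has the form
  w B with a last letter B barred, w non-empty, and the reading of w derives B. The interpretation
  of A is the set of all non-empty words whose reading derives A. It is closed because it is
  determined by the single context (empty word, A barred). Conversely, the one-letter word A lies
  in it, so every context of it ends with a barred letter and expresses the derivability of some
  sequent. Reading barred letters as Top puts every word into the interpretation of Top.
*)
theory Submission
  imports Defs "HOL-Library.Countable"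
begin

section \<open>Letters, the canonical language and the canonical interpretation\<close>

instance fm :: countable
  by countable_datatype

datatype letter = Plain fm | Barred fm

instance letter :: countable
  by countable_datatype

text \<open>Models in \<open>pscl_consequence\<close> have natural numbers as letters, so the two
  copies of the formulae are coded by countability.\<close>

definition plain :: "fm \<Rightarrow> nat" where
  "plain A = to_nat (Plain A)"

definition barred :: "fm \<Rightarrow> nat" where
  "barred A = to_nat (Barred A)"

text \<open>\<open>from_nat\<close> is total, so a number that codes no letter is also read as some
  formula; this allows \<open>UNIV\<close> as the alphabet.\<close>

definition reading :: "nat \<Rightarrow> fm" where
  "reading n = (case from_nat n of Plain A \<Rightarrow> A | Barred A \<Rightarrow> Top)"

lemma reading_plain [simp]: "reading (plain A) = A"
  by (simp add: reading_def plain_def)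

lemma barred_eq_iff [simp]: "barred A = barred B \<longleftrightarrow> A = B"
  by (simp add: barred_def)

lemma plain_neq_barred [simp]: "plain A \<noteq> barred B"
  by (simp add: plain_def barred_def)

definition canonical_lang :: "sequent set \<Rightarrow> nat lang" where
  "canonical_lang H = {w @ [barred A] | w A. w \<noteq> [] \<and> ACT H (map reading w) A}"

definition canonical_interp :: "sequent set \<Rightarrow> fm \<Rightarrow> nat lang" where
  "canonical_interp H A = {w. w \<noteq> [] \<and> ACT H (map reading w) A}"

lemma snoc_barred_in_canonical_lang_iff:
  "w @ [barred A] \<in> canonical_lang H \<longleftrightarrow> w \<in> canonical_interp H A"
  by (auto simp: canonical_lang_def canonical_interp_def)

lemma snoc_plain_notin_canonical_lang: "w @ [plain A] \<notin> canonical_lang H"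
  by (auto simp: canonical_lang_def)

lemma snoc_in_canonical_langE:
  assumes "w @ [n] \<in> canonical_lang H"
  obtains A where "n = barred A" "w \<in> canonical_interp H A"
  using assms by (auto simp: canonical_lang_def canonical_interp_def)

lemma plain_in_canonical_interp: "[plain A] \<in> canonical_interp H A"
  by (simp add: canonical_interp_def ACT.ax)

section \<open>Computing closures\<close>

lemma words_plus_UNIV: "words_plus UNIV = - {[]}"
  by (auto simp: words_plus_def)

text \<open>Common criterion for all closures in the model. Assumption \<open>left\<close> is a
  semantic left rule for \<open>A\<close>: each connective supplies it by its own left rule. Every
  context of \<open>M\<close> expresses derivability of a sequent with a hole; \<open>left\<close>
  puts \<open>A\<close> into the hole, and cut replaces \<open>A\<close> by the reading of any word
  deriving it.\<close>

lemma cl_eq_canonical_interp: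
  assumes sub: "M \<subseteq> canonical_interp H A"
    and plain: "v\<^sub>0 @ [plain B\<^sub>0] \<in> M"
    and left: "\<And>\<Gamma> \<Delta> B. (\<And>v. v \<in> M \<Longrightarrow> ACT H (\<Gamma> @ map reading v @ \<Delta>) B) \<Longrightarrow> ACT H (\<Gamma> @ [A] @ \<Delta>) B"
  shows "cl UNIV (canonical_lang H) M = canonical_interp H A"
proof
  have "([], [barred A]) \<in> contexts UNIV (canonical_lang H) M"
    using sub by (auto simp: contexts_def snoc_barred_in_canonical_lang_iff)
  then have "w @ [barred A] \<in> canonical_lang H" if "w \<in> cl UNIV (canonical_lang H) M" for w
    using that by (fastforce simp: cl_def fillers_def)
  then show "cl UNIV (canonical_lang H) M \<subseteq> canonical_interp H A"
    by (auto simp: snoc_barred_in_canonical_lang_iff)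
next
  show "canonical_interp H A \<subseteq> cl UNIV (canonical_lang H) M"
  proof
    fix w assume w: "w \<in> canonical_interp H A"
    have "x @ w @ y \<in> canonical_lang H" if "(x, y) \<in> contexts UNIV (canonical_lang H) M" for x y
    proof -
      have ctx: "x @ v @ y \<in> canonical_lang H" if "v \<in> M" for v
        using that \<open>(x, y) \<in> _\<close> by (auto simp: contexts_def)
      \<comment> \<open>With an empty right context the word from assumption \<open>plain\<close>
        would end in a plain letter.\<close>
      have "y \<noteq> []"
        using ctx[OF plain] snoc_plain_notin_canonical_lang[of "x @ v\<^sub>0" B\<^sub>0 H] by auto
      then obtain y' n where y: "y = y' @ [n]"
        by (cases y rule: rev_cases) auto
      \<comment> \<open>\<open>B\<close> depends on \<open>y\<close> only, so it is the same
        succedent for all \<open>v\<close> in \<open>M\<close>.\<close>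
      then obtain B where n: "n = barred B"
        using ctx[OF plain] snoc_in_canonical_langE[of "x @ (v\<^sub>0 @ [plain B\<^sub>0]) @ y'" n H] by auto
      have "ACT H (map reading x @ map reading v @ map reading y') B" if "v \<in> M" for v
        using ctx[OF that] snoc_barred_in_canonical_lang_iff[of "x @ v @ y'" B H]
        by (simp add: y n canonical_interp_def)
      then have "ACT H (map reading x @ [A] @ map reading y') B"
        by (rule left)
      with w have "x @ w @ y' \<in> canonical_interp H B"
        by (auto simp: canonical_interp_def intro: ACT.cut)
      then show ?thesis
        using snoc_barred_in_canonical_lang_iff[of "x @ w @ y'" B H] by (simp add: y n)
    qed
    then show "w \<in> cl UNIV (canonical_lang H) M"
      using w by (auto simp: cl_def fillers_def words_plus_UNIV canonical_interp_def)
  qed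
qed

lemma closed_canonical_interp: "closed_lang UNIV (canonical_lang H) (canonical_interp H A)"
proof -
  have "cl UNIV (canonical_lang H) (canonical_interp H A) = canonical_interp H A"
  proof (rule cl_eq_canonical_interp)
    show "[] @ [plain A] \<in> canonical_interp H A"
      by (simp add: plain_in_canonical_interp)
    show "ACT H (\<Gamma> @ [A] @ \<Delta>) B"
      if "\<And>v. v \<in> canonical_interp H A \<Longrightarrow> ACT H (\<Gamma> @ map reading v @ \<Delta>) B" for \<Gamma> \<Delta> B
      using that[OF plain_in_canonical_interp] by simp
  qed simp
  then show ?thesis
    by (auto simp: closed_lang_def words_plus_UNIV canonical_interp_def)
qed

section \<open>The operations of the calculus\<close>

lemma concI: "u \<in> M \<Longrightarrow> v \<in> N \<Longrightarrow> u @ v \<in> conc M N"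
  by (auto simp: conc_def)

lemma canonical_interp_Prod:
  "cl UNIV (canonical_lang H) (conc (canonical_interp H A) (canonical_interp H B))
    = canonical_interp H (A \<odot> B)"
proof (rule cl_eq_canonical_interp)
  show "conc (canonical_interp H A) (canonical_interp H B) \<subseteq> canonical_interp H (A \<odot> B)"
    by (auto simp: conc_def canonical_interp_def intro: ACT.prodR)
  show mem: "[plain A] @ [plain B] \<in> conc (canonical_interp H A) (canonical_interp H B)"
    by (intro concI plain_in_canonical_interp)
  show "ACT H (\<Gamma> @ [A \<odot> B] @ \<Delta>) C"
    if "\<And>v. v \<in> conc (canonical_interp H A) (canonical_interp H B)
          \<Longrightarrow> ACT H (\<Gamma> @ map reading v @ \<Delta>) C" for \<Gamma> \<Delta> C
    using that[OF mem] ACT.prodL[of H \<Gamma> A B \<Delta> C] by simp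
qed

lemma canonical_interp_Or:
  "cl UNIV (canonical_lang H) (canonical_interp H A \<union> canonical_interp H B)
    = canonical_interp H (A \<squnion>\<^sub>f B)"
proof (rule cl_eq_canonical_interp)
  show "canonical_interp H A \<union> canonical_interp H B \<subseteq> canonical_interp H (A \<squnion>\<^sub>f B)"
    by (auto simp: canonical_interp_def intro: ACT.orR1 ACT.orR2)
  show "[] @ [plain A] \<in> canonical_interp H A \<union> canonical_interp H B"
    by (simp add: plain_in_canonical_interp)
  show "ACT H (\<Gamma> @ [A \<squnion>\<^sub>f B] @ \<Delta>) C"
    if "\<And>v. v \<in> canonical_interp H A \<union> canonical_interp H B
          \<Longrightarrow> ACT H (\<Gamma> @ map reading v @ \<Delta>) C" for \<Gamma> \<Delta> C
    using that[OF UnI1[OF plain_in_canonical_interp]] that[OF UnI2[OF plain_in_canonical_interp]]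
    by (intro ACT.orL) simp_all
qed

text \<open>The words \<open>replicate n (plain A)\<close> with n \<ge> 1 read as exactly the
  premises of the \<omega>-rule, which gives the left rule; the inclusion is the right rule applied
  to the readings of the factors.\<close>

lemma canonical_interp_Iter:
  "cl UNIV (canonical_lang H) (lang_plus (canonical_interp H A)) = canonical_interp H (A\<^sup>\<oplus>)"
proof (rule cl_eq_canonical_interp)
  show "lang_plus (canonical_interp H A) \<subseteq> canonical_interp H (A\<^sup>\<oplus>)"
  proof
    fix w assume "w \<in> lang_plus (canonical_interp H A)"
    then obtain ws where ws: "w = concat ws" "ws \<noteq> []" "set ws \<subseteq> canonical_interp H A"
      by (auto simp: lang_plus_def)
    have "ACT H (concat (map (map reading) ws)) (A\<^sup>\<oplus>)"
      using ws by (intro ACT.iterR) (auto simp: canonical_interp_def)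
    moreover have "w \<noteq> []"
      using ws by (cases ws) (auto simp: canonical_interp_def)
    ultimately show "w \<in> canonical_interp H (A\<^sup>\<oplus>)"
      using ws by (simp add: canonical_interp_def map_concat)
  qed
  have mem: "replicate n (plain A) \<in> lang_plus (canonical_interp H A)" if "n \<ge> 1" for n
  proof -
    have "concat (replicate n [plain A]) = replicate n (plain A)"
      by (induction n) auto
    then show ?thesis
      using that plain_in_canonical_interp[of A H] unfolding lang_plus_def
      by (intro CollectI exI[of _ "replicate n [plain A]"]) auto
  qed
  show "[] @ [plain A] \<in> lang_plus (canonical_interp H A)"
    using mem[of 1] by simp
  show "ACT H (\<Gamma> @ [A\<^sup>\<oplus>] @ \<Delta>) C"
    if "\<And>v. v \<in> lang_plus (canonical_interp H A) \<Longrightarrow> ACT H (\<Gamma> @ map reading v @ \<Delta>) C" for \<Gamma> \<Delta> C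
    using that[OF mem] by (intro ACT.iterL) (simp add: map_replicate)
qed

text \<open>One inclusion is cut with A, \<open>A \<rightharpoondown> B\<close> \<rightarrow> B; for
  the other, the single test word \<open>[plain A]\<close> yields the premise of the right
  rule.\<close>

lemma canonical_interp_Under:
  "canonical_interp H (A \<rightharpoondown> B) = under_lang UNIV (canonical_interp H A) (canonical_interp H B)"
proof (intro equalityI subsetI)
  fix u assume u: "u \<in> canonical_interp H (A \<rightharpoondown> B)"
  have "v @ u \<in> canonical_interp H B" if "v \<in> canonical_interp H A" for v
  proof -
    have "ACT H (map reading v @ [A \<rightharpoondown> B]) B"
      using that ACT.underL[of H "map reading v" A "[]" B "[]" B]
      by (auto simp: canonical_interp_def intro: ACT.ax)
    then show ?thesis
      using u ACT.cut[of H "map reading u" "A \<rightharpoondown> B" "map reading v" "[]" B]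
      by (simp add: canonical_interp_def)
  qed
  then show "u \<in> under_lang UNIV (canonical_interp H A) (canonical_interp H B)"
    using u by (auto simp: under_lang_def words_plus_UNIV canonical_interp_def)
next
  fix u assume u: "u \<in> under_lang UNIV (canonical_interp H A) (canonical_interp H B)"
  then have "[plain A] @ u \<in> canonical_interp H B"
    using plain_in_canonical_interp unfolding under_lang_def by blast
  with u show "u \<in> canonical_interp H (A \<rightharpoondown> B)"
    by (auto simp: canonical_interp_def under_lang_def words_plus_UNIV intro: ACT.underR)
qed

lemma canonical_interp_Over:
  "canonical_interp H (B \<leftharpoondown> A) = over_lang UNIV (canonical_interp H B) (canonical_interp H A)"
proof (intro equalityI subsetI)
  fix u assume u: "u \<in> canonical_interp H (B \<leftharpoondown> A)"
  have "u @ v \<in> canonical_interp H B" if "v \<in> canonical_interp H A" for v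
  proof -
    have "ACT H ([B \<leftharpoondown> A] @ map reading v) B"
      using that ACT.overL[of H "map reading v" A "[]" B "[]" B]
      by (auto simp: canonical_interp_def intro: ACT.ax)
    then show ?thesis
      using u ACT.cut[of H "map reading u" "B \<leftharpoondown> A" "[]" "map reading v" B]
      by (simp add: canonical_interp_def)
  qed
  then show "u \<in> over_lang UNIV (canonical_interp H B) (canonical_interp H A)"
    using u by (auto simp: over_lang_def words_plus_UNIV canonical_interp_def)
next
  fix u assume u: "u \<in> over_lang UNIV (canonical_interp H B) (canonical_interp H A)"
  then have "u @ [plain A] \<in> canonical_interp H B"
    using plain_in_canonical_interp unfolding over_lang_def by blast
  with u show "u \<in> canonical_interp H (B \<leftharpoondown> A)"
    by (auto simp: canonical_interp_def over_lang_def words_plus_UNIV intro: ACT.overR)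
qed

lemma canonical_interp_And:
  "canonical_interp H (A \<sqinter>\<^sub>f B) = canonical_interp H A \<inter> canonical_interp H B"
proof -
  have "ACT H [A \<sqinter>\<^sub>f B] A" "ACT H [A \<sqinter>\<^sub>f B] B"
    using ACT.andL1[of H "[]" A "[]" A B] ACT.andL2[of H "[]" B "[]" B A] by (simp_all add: ACT.ax)
  then show ?thesis
    using ACT.cut[of H _ "A \<sqinter>\<^sub>f B" "[]" "[]"]
    by (auto simp: canonical_interp_def intro: ACT.andR)
qed

section \<open>The constants and the local zero\<close>

lemma canonical_interp_Top: "canonical_interp H Top = words_plus UNIV"
  by (auto simp: canonical_interp_def words_plus_UNIV intro: ACT.top)

lemma canonical_interp_Bot_subset: "canonical_interp H Bot \<subseteq> canonical_interp H A"
  using ACT.cut[of H _ Bot "[]" "[]" A] ACT.bot[of H "[]" "[]" A]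
  by (auto simp: canonical_interp_def)

text \<open>The axiom for \<open>Bot\<close> has arbitrary side formulae, so any word next to one
  deriving \<open>Bot\<close> is absorbed.\<close>

lemma local_zero_canonical_interp_Bot:
  "local_zero UNIV (canonical_lang H) (canonical_interp H Bot)"
  unfolding local_zero_def
proof (intro conjI allI impI closed_canonical_interp; elim conjE)
  fix M assume sub: "canonical_interp H Bot \<subseteq> M"
  then have mem: "[plain Bot] \<in> M"
    using plain_in_canonical_interp by blast
  show "cl UNIV (canonical_lang H) (conc M (canonical_interp H Bot)) = canonical_interp H Bot"
  proof (rule cl_eq_canonical_interp)
    have "ACT H (map reading u @ map reading v) Bot" if "v \<in> canonical_interp H Bot" for u v
      using that ACT.cut[of H "map reading v" Bot "map reading u" "[]" Bot]
        ACT.bot[of H "map reading u" "[]" Bot]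
      by (auto simp: canonical_interp_def)
    then show "conc M (canonical_interp H Bot) \<subseteq> canonical_interp H Bot"
      by (auto simp: conc_def canonical_interp_def)
    show "[plain Bot] @ [plain Bot] \<in> conc M (canonical_interp H Bot)"
      by (intro concI mem plain_in_canonical_interp)
  \<comment> \<open>The remaining goal is the semantic left rule for \<open>Bot\<close>, whose
    conclusion is already an axiom.\<close>
  qed (rule ACT.bot)
  show "cl UNIV (canonical_lang H) (conc (canonical_interp H Bot) M) = canonical_interp H Bot"
  proof (rule cl_eq_canonical_interp)
    have "ACT H (map reading u @ map reading v) Bot" if "u \<in> canonical_interp H Bot" for u v
      using that ACT.cut[of H "map reading u" Bot "[]" "map reading v" Bot]
        ACT.bot[of H "[]" "map reading v" Bot]
      by (auto simp: canonical_interp_def)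
    then show "conc (canonical_interp H Bot) M \<subseteq> canonical_interp H Bot"
      by (auto simp: conc_def canonical_interp_def)
    show "[plain Bot] @ [plain Bot] \<in> conc (canonical_interp H Bot) M"
      by (intro concI mem plain_in_canonical_interp)
  qed (rule ACT.bot)
qed

lemma pscl_model_canonical:
  "pscl_model UNIV (canonical_lang H) (canonical_interp H Bot) (canonical_interp H)"
proof -
  have "canonical_lang H \<subseteq> words_plus UNIV"
    by (auto simp: words_plus_UNIV canonical_lang_def)
  then show ?thesis
    by (simp add: pscl_model_def canonical_interp_Prod canonical_interp_Or canonical_interp_Iter
        canonical_interp_Under canonical_interp_Over canonical_interp_And canonical_interp_Top
        local_zero_canonical_interp_Bot closed_canonical_interp canonical_interp_Bot_subset)
qed

section \<open>Antecedents as products, and truth in the canonical model\<close>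

lemma ACT_foldl_Prod_left: "ACT H (A # As) C \<Longrightarrow> ACT H [foldl (\<odot>) A As] C"
proof (induction As arbitrary: A)
  case (Cons B As)
  then show ?case
    using ACT.prodL[of H "[]" A B As C] by simp
qed simp

text \<open>The prefix \<Gamma> stands for what the accumulator of the fold has consumed, so that
  the induction goes through.\<close>

lemma ACT_foldl_Prod_right: "ACT H \<Gamma> A \<Longrightarrow> ACT H (\<Gamma> @ As) (foldl (\<odot>) A As)"
proof (induction As arbitrary: \<Gamma> A)
  case (Cons B As)
  then show ?case
    using Cons.IH[of "\<Gamma> @ [B]" "A \<odot> B"] ACT.prodR[OF Cons.prems ACT.ax] by simp
qed simp

lemma foldl_canonical_interp:
  "foldl (\<lambda>M A. cl UNIV (canonical_lang H) (conc M (canonical_interp H A))) (canonical_interp H A) As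
    = canonical_interp H (foldl (\<odot>) A As)"
  by (induction As arbitrary: A) (simp_all add: canonical_interp_Prod)

text \<open>The word \<open>[plain A]\<close> is a generic element: testing the inclusion on it
  alone gives derivability, and cut extends this to all words.\<close>

lemma canonical_interp_subset_iff:
  "canonical_interp H A \<subseteq> canonical_interp H B \<longleftrightarrow> ACT H [A] B"
proof
  assume "canonical_interp H A \<subseteq> canonical_interp H B"
  then have "[plain A] \<in> canonical_interp H B"
    using plain_in_canonical_interp by blast
  then show "ACT H [A] B"
    by (simp add: canonical_interp_def)
next
  assume "ACT H [A] B"
  then show "canonical_interp H A \<subseteq> canonical_interp H B"
    using ACT.cut[of H _ A "[]" "[]" B] by (auto simp: canonical_interp_def)
qed

text \<open>Truth lemma, used from right to left for the hypotheses and from left to right for the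
  sequent in question.\<close>

lemma true_in_canonical_iff:
  assumes "\<Gamma> \<noteq> []"
  shows "true_in UNIV (canonical_lang H) (canonical_interp H) (\<Gamma>, C) \<longleftrightarrow> ACT H \<Gamma> C"
proof -
  obtain A As where \<Gamma>: "\<Gamma> = A # As"
    using assms by (cases \<Gamma>) auto
  \<comment> \<open>Inverts the left product rule by a cut with the sequent deriving the product
    from its factors.\<close>
  have "ACT H [foldl (\<odot>) A As] C \<Longrightarrow> ACT H (A # As) C"
    using ACT_foldl_Prod_right[OF ACT.ax, of H A As]
      ACT.cut[of H "A # As" "foldl (\<odot>) A As" "[]" "[]" C] by simp
  then show ?thesis
    by (auto simp: \<Gamma> true_in_def foldl_canonical_interp canonical_interp_subset_iff
        intro: ACT_foldl_Prod_left)
qed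

theorem theorem1:
  fixes H :: "sequent set" and \<Pi> :: "fm list" and C :: fm
  assumes "\<forall>S\<in>H. wf_sequent S"
    and "wf_sequent (\<Pi>, C)"
    and "pscl_consequence H (\<Pi>, C)"
  shows "ACT H \<Pi> C"
proof -
  have "true_in UNIV (canonical_lang H) (canonical_interp H) T" if "T \<in> H" for T
    using that assms(1) true_in_canonical_iff[of "fst T" H "snd T"] ACT.hyp[of "fst T" "snd T" H]
    by (auto simp: wf_sequent_def)
  then have "true_in UNIV (canonical_lang H) (canonical_interp H) (\<Pi>, C)"
    using assms(3) pscl_model_canonical unfolding pscl_consequence_def by blast
  then show ?thesis
    using assms(2) by (simp add: wf_sequent_def true_in_canonical_iff)
qed

end
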